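(* Let $\varepsilon > 0$ and let $\mathcal{C}$ be a family of convex sets in $\mathbb{R}^d$ that has a Minkowski parametrization in $\mathbb{R}^l$. Let $\mathcal{F}$ be a finite family of convex sets in $\mathbb{R}^d$ such that for every subfamily $\mathcal{F}'$ of $l+d+1$ or fewer sets of $\mathcal{F}$ there exists a translation of a set in $\mathcal{C}$ that is a simultaneous $\varepsilon$-approximation for all sets in $\mathcal{F}'$. Then there exists a translation of a set in $\mathcal{C}$ that is a simultaneous $\varepsilon$-approximation for all sets in $\mathcal{F}$.
   Context: $\oplus$ denotes the Minkowski sum. A family $\mathcal{C}$ of convex sets in $\mathbb{R}^d$ has a Minkowski parametrization in $\mathbb{R}^l$ if there is a surjective function $D : \mathbb{R}^l \to \mathcal{C}$ such that $D(\lambda a + (1-\lambda) b) = (\lambda D(a)) \oplus ((1-\lambda) D(b))$ for all $a, b \in \mathbb{R}^l$ and $\lambda \in [0,1]$. For sets $A, K \subset \mathbb{R}^d$, a translation of $A$ with center $a \in \mathbb{R}^d$ is an $\varepsilon$-approximation of $K$ if $a + A \subset K \subset a + (1+\varepsilon)A$. A translation of $A$ simultaneously $\varepsilon$-approximates a family $\mathcal{F}'$ if there is a single $a \in \mathbb{R}^d$ such that $a + A \subset K \subset a + (1+\varepsilon)A$ for all $K \in \mathcal{F}'$. *)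

theory Defs
  imports "HOL-Analysis.Analysis" "HOL-Library.Set_Algebras" "Jordan_Normal_Form.Matrix"
begin

text \<open>
  The parameter space is \<open>carrier_vec l\<close>, so that \<open>l\<close> is an arbitrary natural number;
  the case \<open>l = 0\<close> is that of a family consisting of a single convex set.
  The sum of two sets is the Minkowski sum of \<open>Set_Algebras\<close>.
\<close>

definition minkowski_parametrization ::
    "nat \<Rightarrow> (real Matrix.vec \<Rightarrow> (real ^ 'd) set) \<Rightarrow> (real ^ 'd) set set \<Rightarrow> bool" where
  "minkowski_parametrization l D \<C> \<longleftrightarrow>
     D ` carrier_vec l = \<C> \<and>
     (\<forall>a\<in>carrier_vec l. \<forall>b\<in>carrier_vec l. \<forall>t\<in>{0..1}.
        D (t \<cdot>\<^sub>v a + (1 - t) \<cdot>\<^sub>v b) = (*\<^sub>R) t ` D a + (*\<^sub>R) (1 - t) ` D b)"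

definition has_minkowski_parametrization :: "(real ^ 'd) set set \<Rightarrow> nat \<Rightarrow> bool" where
  "has_minkowski_parametrization \<C> l \<longleftrightarrow> (\<exists>D. minkowski_parametrization l D \<C>)"

definition eps_approximation ::
    "real \<Rightarrow> real ^ 'd \<Rightarrow> (real ^ 'd) set \<Rightarrow> (real ^ 'd) set \<Rightarrow> bool" where
  "eps_approximation \<epsilon> a A K \<longleftrightarrow>
     (+) a ` A \<subseteq> K \<and> K \<subseteq> (+) a ` ((*\<^sub>R) (1 + \<epsilon>) ` A)"

definition simultaneous_eps_approximation ::
    "real \<Rightarrow> (real ^ 'd) set \<Rightarrow> (real ^ 'd) set set \<Rightarrow> bool" where
  "simultaneous_eps_approximation \<epsilon> A \<F> \<longleftrightarrow> (\<exists>a. \<forall>K\<in>\<F>. eps_approximation \<epsilon> a A K)"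

end

theory Submission
  imports Defs
begin

text \<open>
  For \<open>K\<close> in \<open>\<F>\<close>, the pairs of a parameter \<open>x\<close> and a center \<open>a\<close> such that \<open>a + D x\<close> is an
  \<open>\<epsilon>\<close>-approximation of \<open>K\<close> form a convex subset of \<open>\<real>\<^sup>l \<times> \<real>\<^sup>d\<close>, because \<open>D\<close> turns convex
  combinations into Minkowski combinations. Helly's theorem in dimension \<open>l + d\<close> gives a pair
  common to all \<open>K\<close>.

  Since \<open>l\<close> is a number rather than a type, Helly's theorem is needed for real functions that
  vanish outside a finite set \<open>J\<close>, a space of dimension \<open>card J\<close>.
\<close>

text \<open>Gaussian elimination by induction on the equations \<open>J\<close>, with
  \<open>I\<close> as unknowns: using one equation to eliminate one unknown lowers both
  cardinalities by one and so keeps the strict inequality.\<close>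

lemma homogeneous_system_nontrivial_solution:
  fixes f :: "'j \<Rightarrow> 'i \<Rightarrow> 'a::field"
  assumes "finite J" "finite I" "card J < card I"
  shows "\<exists>u. (\<exists>i\<in>I. u i \<noteq> 0) \<and> (\<forall>j\<in>J. (\<Sum>i\<in>I. u i * f j i) = 0)"
  using assms
proof (induction J arbitrary: I f rule: finite_induct)
  case empty
  then have "I \<noteq> {}" by auto
  then show ?case by (intro exI[of _ "\<lambda>_. 1"]) auto
next
  case (insert j0 J)
  show ?case
  proof (cases "\<forall>i\<in>I. f j0 i = 0")
    case True
    have "card J < card I" using insert by simp
    from insert.IH[OF insert.prems(1) this, of f] obtain u
      where "\<exists>i\<in>I. u i \<noteq> 0" "\<forall>j\<in>J. (\<Sum>i\<in>I. u i * f j i) = 0" by blast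
    with True show ?thesis by (intro exI[of _ u]) auto
  next
    case False
    then obtain i0 where i0: "i0 \<in> I" "f j0 i0 \<noteq> 0" by blast
    define I' where "I' = I - {i0}"
    have I': "finite I'" "i0 \<notin> I'" "I = insert i0 I'"
      using i0 insert.prems by (auto simp: I'_def)
    have "card J < card I'" using insert I' by simp
    \<comment> \<open>From each equation \<open>j\<close>, the multiple of equation
      \<open>j0\<close> is subtracted that cancels the unknown \<open>i0\<close>.\<close>
    from insert.IH[OF I'(1) this, of "\<lambda>j i. f j i - f j i0 / f j0 i0 * f j0 i"] obtain u
      where u: "\<exists>i\<in>I'. u i \<noteq> 0"
        "\<forall>j\<in>J. (\<Sum>i\<in>I'. u i * (f j i - f j i0 / f j0 i0 * f j0 i)) = 0" by blast
    define s where "s = (\<Sum>i\<in>I'. u i * f j0 i)"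
    \<comment> \<open>Back substitution: the value at \<open>i0\<close> is the one that solves
      equation \<open>j0\<close>.\<close>
    define v where "v = u(i0 := - s / f j0 i0)"
    have v: "(\<Sum>i\<in>I. v i * f j i) = - s / f j0 i0 * f j i0 + (\<Sum>i\<in>I'. u i * f j i)" for j
    proof -
      have "(\<Sum>i\<in>I'. v i * f j i) = (\<Sum>i\<in>I'. u i * f j i)"
        using I' by (intro sum.cong) (auto simp: v_def)
      then show ?thesis using I' by (simp add: v_def)
    qed
    have "(\<Sum>i\<in>I. v i * f j i) = 0" if "j \<in> J" for j
    proof -
      have "0 = (\<Sum>i\<in>I'. u i * f j i - f j i0 / f j0 i0 * (u i * f j0 i))"
        using u(2)[rule_format, OF that] by (simp add: algebra_simps)
      also have "\<dots> = (\<Sum>i\<in>I'. u i * f j i) - f j i0 / f j0 i0 * s"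
        by (simp add: sum_subtractf s_def sum_distrib_left)
      finally show ?thesis unfolding v by (simp add: algebra_simps)
    qed
    moreover have "(\<Sum>i\<in>I. v i * f j0 i) = 0"
      unfolding v using i0 by (simp add: s_def)
    moreover have "\<exists>i\<in>I. v i \<noteq> 0" using u(1) I' by (auto simp: v_def)
    ultimately show ?thesis by blast
  qed
qed

definition pointwise_convex :: "('j \<Rightarrow> real) set \<Rightarrow> bool" where
  "pointwise_convex S \<longleftrightarrow>
     (\<forall>f\<in>S. \<forall>g\<in>S. \<forall>t\<in>{0..1}. (\<lambda>j. t * f j + (1 - t) * g j) \<in> S)"

lemma pointwise_convexD:
  assumes "pointwise_convex S" "f \<in> S" "g \<in> S" "t \<in> {0..1}"
  shows "(\<lambda>j. t * f j + (1 - t) * g j) \<in> S"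
  using assms unfolding pointwise_convex_def by simp

text \<open>One point is split off and the other weights are divided by \<open>1 - w a\<close>, so
  that they sum to 1 again; hence the induction is over arbitrary \<open>w\<close>. If
  \<open>w a = 1\<close>, the other weights vanish.\<close>

lemma pointwise_convex_sum:
  assumes "pointwise_convex S" "finite A"
    and "\<And>i. i \<in> A \<Longrightarrow> 0 \<le> w i" "sum w A = 1" "\<And>i. i \<in> A \<Longrightarrow> p i \<in> S"
  shows "(\<lambda>j. \<Sum>i\<in>A. w i * p i j) \<in> S"
  using assms(2-)
proof (induction A arbitrary: w rule: finite_induct)
  case empty
  then show ?case by simp
next
  case (insert a A)
  have sumA: "sum w A = 1 - w a" using insert by simp
  have nonneg: "0 \<le> sum w A" using insert by (intro sum_nonneg) auto
  show ?case
  proof (cases "w a = 1")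
    case True
    then have "\<forall>i\<in>A. w i = 0"
      using sumA insert by (subst sum_nonneg_eq_0_iff[symmetric]) auto
    then have "(\<lambda>j. \<Sum>i\<in>insert a A. w i * p i j) = p a"
      using insert True by (intro ext) simp
    then show ?thesis using insert by simp
  next
    case False
    then have pos: "0 < 1 - w a" using sumA nonneg by linarith
    have "(\<lambda>j. \<Sum>i\<in>A. w i / (1 - w a) * p i j) \<in> S"
    proof (rule insert.IH)
      show "(\<Sum>i\<in>A. w i / (1 - w a)) = 1"
        using sumA pos by (simp flip: sum_divide_distrib)
    qed (use insert pos in auto)
    from pointwise_convexD[OF assms(1) _ this, of "p a" "w a"] have
      "(\<lambda>j. w a * p a j + (1 - w a) * (\<Sum>i\<in>A. w i / (1 - w a) * p i j)) \<in> S"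
      using insert pos by simp
    moreover have "(1 - w a) * (\<Sum>i\<in>A. w i / (1 - w a) * p i j) = (\<Sum>i\<in>A. w i * p i j)" for j
      using pos by (simp add: sum_distrib_left)
    ultimately show ?thesis using insert by simp
  qed
qed

text \<open>Radon's argument: if every proper subfamily has a common point, choose for each
  \<open>i\<close> a point \<open>p i\<close> of all the sets except possibly \<open>S i\<close>.
  With at least \<open>card J + 2\<close> such points, some two disjoint groups of them have convex
  hulls that meet, and a point where they meet lies in every set.\<close>

theorem Helly_finite_support:
  fixes S :: "'i \<Rightarrow> ('j \<Rightarrow> real) set"
  assumes "finite J" "finite I"
    and "\<And>i. i \<in> I \<Longrightarrow> pointwise_convex (S i)"
    and "\<And>i f j. i \<in> I \<Longrightarrow> f \<in> S i \<Longrightarrow> j \<notin> J \<Longrightarrow> f j = 0"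
    and "\<And>I'. I' \<subseteq> I \<Longrightarrow> card I' \<le> card J + 1 \<Longrightarrow> \<exists>f. \<forall>i\<in>I'. f \<in> S i"
  shows "\<exists>f. \<forall>i\<in>I. f \<in> S i"
  using assms(2-)
proof (induction I rule: finite_psubset_induct)
  case (psubset I)
  show ?case
  proof (cases "card I \<le> card J + 1")
    case True
    then show ?thesis using psubset.prems(3) by blast
  next
    case False
    have "\<exists>f. \<forall>k\<in>I - {i}. f \<in> S k" if "i \<in> I" for i
    proof (rule psubset.IH)
      show "\<exists>f. \<forall>k\<in>I'. f \<in> S k" if "I' \<subseteq> I - {i}" "card I' \<le> card J + 1" for I'
        using psubset.prems(3)[of I'] that by blast
    qed (use that psubset.prems in auto)
    then obtain p where p: "\<And>i k. i \<in> I \<Longrightarrow> k \<in> I \<Longrightarrow> k \<noteq> i \<Longrightarrow> p i \<in> S k"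
      by (metis Diff_iff empty_iff insert_iff)
    \<comment> \<open>An affine dependence among the \<open>p i\<close>; the equation \<open>None\<close> makes its coefficients sum to 0.\<close>
    have "card (insert None (Some ` J)) < card I"
      using assms(1) False by (simp add: card_image)
    from homogeneous_system_nontrivial_solution[OF _ psubset(1) this,
        of "\<lambda>j i. case j of None \<Rightarrow> 1 | Some k \<Rightarrow> p i k"] assms(1)
    obtain u where "\<exists>i\<in>I. u i \<noteq> 0" and
      u0: "\<forall>j\<in>insert None (Some ` J).
            (\<Sum>i\<in>I. u i * (case j of None \<Rightarrow> 1 | Some k \<Rightarrow> p i k)) = 0"
      by auto
    then obtain i1 where i1: "i1 \<in> I" "u i1 \<noteq> 0" by blast
    have up: "(\<Sum>i\<in>I. u i * p i j) = 0" if "j \<in> J" for j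
      using u0 that by auto
    have usum: "sum u I = 0" using u0 by auto
    \<comment> \<open>The Radon partition, by the sign of the coefficients. Zero coefficients may go
      to \<open>N\<close>, where they become zero weights.\<close>
    define P N where "P = {i\<in>I. 0 < u i}" and "N = {i\<in>I. u i \<le> 0}"
    have PN: "finite P" "finite N" "P \<inter> N = {}" "I = P \<union> N"
      using psubset(1) by (auto simp: P_def N_def)
    define s where "s = sum u P"
    have sN: "sum (\<lambda>i. - u i) N = s"
      using usum PN by (simp add: sum.union_disjoint s_def sum_negf)
    \<comment> \<open>Were no coefficient positive, a zero sum would force all of them to vanish,
      against the choice of \<open>i1\<close>. Hence \<open>s\<close> is positive and can normalize
      the weights.\<close>
    have "P \<noteq> {}"
    proof
      assume "P = {}"
      then have "sum (\<lambda>i. - u i) N = 0" using sN by (simp add: s_def)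
      then have "\<forall>i\<in>N. - u i = 0"
        using PN(2) by (subst (asm) sum_nonneg_eq_0_iff) (auto simp: N_def)
      then show False using i1 \<open>P = {}\<close> PN by auto
    qed
    then have s: "0 < s" unfolding s_def using PN(1) by (intro sum_pos) (auto simp: P_def)
    \<comment> \<open>The Radon point: moving the negative terms of the dependence to the other side
      and dividing by \<open>s\<close> makes it a convex combination over \<open>P\<close> and also
      over \<open>N\<close>.\<close>
    define z where "z = (\<lambda>j. \<Sum>i\<in>P. u i / s * p i j)"
    have zN: "z = (\<lambda>j. \<Sum>i\<in>N. - u i / s * p i j)"
    proof
      fix j
      have "(\<Sum>i\<in>I. u i * p i j) = 0"
      proof (cases "j \<in> J")
        \<comment> \<open>The dependence was only imposed on coordinates in \<open>J\<close>.
          Elsewhere each \<open>p i\<close> vanishes, because \<open>I\<close> has at least two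
          elements and so \<open>p i\<close> lies in some \<open>S k\<close>.\<close>
        case False
        have "\<exists>k\<in>I. k \<noteq> i" if "i \<in> I" for i
        proof (rule ccontr)
          assume "\<not> ?thesis"
          then have "I \<subseteq> {i}" by blast
          then have "card I \<le> 1" using card_mono[of "{i}" I] by simp
          then show False using \<open>\<not> card I \<le> card J + 1\<close> by linarith
        qed
        then have "p i j = 0" if "i \<in> I" for i
          using p psubset.prems(2) False that by metis
        then show ?thesis by simp
      qed (rule up)
      then have "(\<Sum>i\<in>P. u i * p i j) = (\<Sum>i\<in>N. - u i * p i j)"
        using PN by (simp add: sum.union_disjoint sum_negf)
      then have "(\<Sum>i\<in>P. u i * p i j) / s = (\<Sum>i\<in>N. - u i * p i j) / s" by simp
      then show "z j = (\<Sum>i\<in>N. - u i / s * p i j)"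
        by (simp add: z_def sum_divide_distrib)
    qed
    \<comment> \<open>The combination is taken over the part that does not contain \<open>k\<close>:
      all its points \<open>p i\<close> have \<open>i \<noteq> k\<close> and thus lie in
      \<open>S k\<close>.\<close>
    have "z \<in> S k" if k: "k \<in> I" for k
    proof (cases "k \<in> P")
      case True
      show ?thesis unfolding zN
      proof (rule pointwise_convex_sum[OF psubset.prems(1)[OF k]])
        show "(\<Sum>i\<in>N. - u i / s) = 1" using sN s by (simp only: sum_divide_distrib[symmetric]) simp
        show "p i \<in> S k" if "i \<in> N" for i
          using p[of i k] that k True PN by auto
      qed (use PN(1,2) s in \<open>auto simp: N_def divide_nonpos_pos\<close>)
    next
      case False
      show ?thesis unfolding z_def
      proof (rule pointwise_convex_sum[OF psubset.prems(1)[OF k]])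
        show "(\<Sum>i\<in>P. u i / s) = 1" using s by (simp add: s_def flip: sum_divide_distrib)
        show "p i \<in> S k" if "i \<in> P" for i
          using p[of i k] that k False PN by auto
      qed (use PN(1,2) s in \<open>auto simp: P_def\<close>)
    qed
    then show ?thesis by blast
  qed
qed

text \<open>This makes the admissible pairs of parameter and center a convex set. The inner
  inclusion averages two points of \<open>K\<close>; the outer one averages two representations of
  the same point of \<open>K\<close>.\<close>

lemma eps_approximation_convex_combination:
  assumes K: "convex K" and t: "t \<in> {0..1}"
    and A: "eps_approximation \<epsilon> a A K" and B: "eps_approximation \<epsilon> b B K"
  shows "eps_approximation \<epsilon> (t *\<^sub>R a + (1 - t) *\<^sub>R b) ((*\<^sub>R) t ` A + (*\<^sub>R) (1 - t) ` B) K"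
  unfolding eps_approximation_def
proof (intro conjI subsetI)
  fix y
  assume "y \<in> (+) (t *\<^sub>R a + (1 - t) *\<^sub>R b) ` ((*\<^sub>R) t ` A + (*\<^sub>R) (1 - t) ` B)"
  then obtain x x' where x: "x \<in> A" "x' \<in> B"
    and y: "y = t *\<^sub>R a + (1 - t) *\<^sub>R b + (t *\<^sub>R x + (1 - t) *\<^sub>R x')"
    by (auto simp: set_plus_def)
  have "a + x \<in> K" "b + x' \<in> K"
    using x A B by (auto simp: eps_approximation_def)
  then have "t *\<^sub>R (a + x) + (1 - t) *\<^sub>R (b + x') \<in> K"
    using K t by (intro convexD) auto
  then show "y \<in> K" by (simp add: y algebra_simps)
next
  fix y assume "y \<in> K"
  then have "y \<in> (+) a ` ((*\<^sub>R) (1 + \<epsilon>) ` A)" "y \<in> (+) b ` ((*\<^sub>R) (1 + \<epsilon>) ` B)"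
    using A B unfolding eps_approximation_def by (simp_all add: subset_iff)
  then obtain x x' where x: "x \<in> A" "x' \<in> B"
    and y: "y = a + (1 + \<epsilon>) *\<^sub>R x" "y = b + (1 + \<epsilon>) *\<^sub>R x'"
    by (elim imageE) simp
  have "y = t *\<^sub>R y + (1 - t) *\<^sub>R y" by (simp add: algebra_simps)
  also have "\<dots> = t *\<^sub>R (a + (1 + \<epsilon>) *\<^sub>R x) + (1 - t) *\<^sub>R (b + (1 + \<epsilon>) *\<^sub>R x')"
    by (simp only: y(1)[symmetric] y(2)[symmetric])
  also have "\<dots> = t *\<^sub>R a + (1 - t) *\<^sub>R b + (1 + \<epsilon>) *\<^sub>R (t *\<^sub>R x + (1 - t) *\<^sub>R x')"
    by (simp add: algebra_simps)
  finally show "y \<in> (+) (t *\<^sub>R a + (1 - t) *\<^sub>R b) `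
      ((*\<^sub>R) (1 + \<epsilon>) ` ((*\<^sub>R) t ` A + (*\<^sub>R) (1 - t) ` B))"
    using x by blast
qed

theorem theorem2p5:
  fixes \<epsilon> :: real and l :: nat and \<C> \<F> :: "(real ^ 'd) set set"
  assumes "\<epsilon> > 0"
    and "\<forall>A\<in>\<C>. convex A"
    and "has_minkowski_parametrization \<C> l"
    and "finite \<F>"
    and "\<forall>K\<in>\<F>. convex K"
    and "\<forall>\<F>'. \<F>' \<subseteq> \<F> \<and> card \<F>' \<le> l + CARD('d) + 1 \<longrightarrow>
           (\<exists>A\<in>\<C>. simultaneous_eps_approximation \<epsilon> A \<F>')"
  shows "\<exists>A\<in>\<C>. simultaneous_eps_approximation \<epsilon> A \<F>"
proof -
  obtain D where range_D: "D ` carrier_vec l = \<C>" and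
    D: "\<And>a b t. a \<in> carrier_vec l \<Longrightarrow> b \<in> carrier_vec l \<Longrightarrow> t \<in> {0..1} \<Longrightarrow>
        D (t \<cdot>\<^sub>v a + (1 - t) \<cdot>\<^sub>v b) = (*\<^sub>R) t ` D a + (*\<^sub>R) (1 - t) ` D b"
    using assms(3) unfolding has_minkowski_parametrization_def minkowski_parametrization_def
    by blast
  \<comment> \<open>\<open>Inl i\<close> indexes the coordinates of the parameter and
    \<open>Inr k\<close> those of the center, so \<open>card J + 1\<close> is the Helly number
    \<open>l + d + 1\<close>.\<close>
  define J :: "(nat + 'd) set" where "J = {..<l} <+> UNIV"
  have cardJ: "card J = l + CARD('d)" and finJ: "finite J"
    by (auto simp: J_def card_Plus)
  define param :: "(nat + 'd \<Rightarrow> real) \<Rightarrow> real Matrix.vec"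
    where "param f = Matrix.vec l (\<lambda>i. f (Inl i))" for f
  define center :: "(nat + 'd \<Rightarrow> real) \<Rightarrow> real ^ 'd"
    where "center f = (\<chi> k. f (Inr k))" for f
  define S where "S K = {f. (\<forall>j. j \<notin> J \<longrightarrow> f j = 0) \<and>
      eps_approximation \<epsilon> (center f) (D (param f)) K}" for K
  have carrier: "param f \<in> carrier_vec l" for f by (simp add: param_def)
  have conv: "pointwise_convex (S K)" if "K \<in> \<F>" for K
    unfolding pointwise_convex_def
  proof (intro ballI)
    fix f g t assume f: "f \<in> S K" and g: "g \<in> S K" and t: "t \<in> {0..1::real}"
    let ?h = "\<lambda>j. t * f j + (1 - t) * g j"
    have "param ?h = t \<cdot>\<^sub>v param f + (1 - t) \<cdot>\<^sub>v param g"
      by (intro eq_vecI) (auto simp: param_def)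
    moreover have "center ?h = t *\<^sub>R center f + (1 - t) *\<^sub>R center g"
      by (simp add: center_def Finite_Cartesian_Product.vec_eq_iff)
    \<comment> \<open>\<open>param\<close> and \<open>center\<close> respect convex combinations,
      and \<open>D\<close> turns the one of the parameters into a Minkowski combination of
      sets.\<close>
    ultimately have "eps_approximation \<epsilon> (center ?h) (D (param ?h)) K"
      using eps_approximation_convex_combination[of K t] f g t that assms(5) D carrier
      by (simp add: S_def)
    then show "?h \<in> S K" using f g by (simp add: S_def)
  qed
  have common: "\<exists>f. \<forall>K\<in>\<F>'. f \<in> S K" if sub: "\<F>' \<subseteq> \<F>" "card \<F>' \<le> card J + 1" for \<F>'
  proof -
    obtain A where "A \<in> D ` carrier_vec l" "simultaneous_eps_approximation \<epsilon> A \<F>'"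
      using assms(6)[rule_format, of \<F>'] sub unfolding cardJ range_D by blast
    then obtain x a where x: "x \<in> carrier_vec l" and a: "\<forall>K\<in>\<F>'. eps_approximation \<epsilon> a (D x) K"
      unfolding simultaneous_eps_approximation_def by (elim imageE exE) simp
    \<comment> \<open>The pair of \<open>x\<close> and \<open>a\<close> as one function; the value 0
      at \<open>Inl i\<close> for \<open>i \<ge> l\<close> meets the support condition of
      \<open>S\<close>.\<close>
    define f where
      "f = case_sum (\<lambda>i. if i < l then vec_index x i else 0) (\<lambda>k. vec_nth a k)"
    have "param f = x" using x by (intro eq_vecI) (auto simp: param_def f_def)
    moreover have "center f = a" by (simp add: center_def f_def)
    moreover have "f j = 0" if "j \<notin> J" for j
      using that by (cases j) (auto simp: f_def J_def)
    ultimately show ?thesis using a by (auto simp: S_def)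
  qed
  have support: "f j = 0" if "K \<in> \<F>" "f \<in> S K" "j \<notin> J" for K f j
    using that by (simp add: S_def)
  have "\<exists>f. \<forall>K\<in>\<F>. f \<in> S K"
    by (rule Helly_finite_support[where S = S, OF finJ assms(4)]) (fact conv support common)+
  then obtain f where "\<forall>K\<in>\<F>. eps_approximation \<epsilon> (center f) (D (param f)) K"
    by (auto simp: S_def)
  \<comment> \<open>\<open>param f\<close> is a valid parameter for every \<open>f\<close>, so
    \<open>D (param f)\<close> belongs to \<open>\<C>\<close> even if \<open>\<F>\<close> is
    empty.\<close>
  then show ?thesis
    using range_D carrier[of f] unfolding simultaneous_eps_approximation_def by blast
qed

end
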